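(* Let $(F^*,\mathrm{d},\wedge)$ be a differential graded algebra, $\delta:F^n\to F^{n-1}$ a linear map for all $n$, $\alpha\in\mathbb{R}$, and let $(F_{\mathbb{R}}^*,\mathrm{d}_\alpha,\wedge_\alpha)$ and $(F_{\mathbb{R}}^*,\mathrm{d}_0,\wedge_0)$ be the homotopy-deformed DGA and its $\alpha=0$ case, as defined in the context. Then the cohomology of $(F_{\mathbb{R}}^*,\mathrm{d}_0,\wedge_0)$ is the same as (isomorphic to) that of $(F_{\mathbb{R}}^*,\mathrm{d}_\alpha,\wedge_\alpha)$.
   Context: A differential graded algebra (DGA) $(F^*,\mathrm{d},\wedge)$ consists of vector spaces $F^n$, $n\ge 0$, over $k=\mathbb{R}$ or $\mathbb{C}$ (with $F^n=0$ for $n<0$), linear maps $\mathrm{d}:F^n\to F^{n+1}$ and an associative bilinear product $\wedge:F^n\times F^m\to F^{n+m}$ with $\mathrm{d}\,\mathrm{d}=0$ and $\mathrm{d}(\xi\wedge\eta)=\mathrm{d}\xi\wedge\eta+(-1)^{|\xi|}\xi\wedge \mathrm{d}\eta$. Graded commutativity is not assumed. Put $\Delta=\delta\,\mathrm{d}+\mathrm{d}\,\delta$ and $F_{\mathbb{R}}^n=F^n\otimes C^\infty(\mathbb{R})\oplus\big(F^{n-1}\otimes C^\infty(\mathbb{R})\big)\wedge \mathrm{d}t$, where $C^\infty(\mathbb{R})$ is the algebra of smooth $k$-valued functions of time $t$, $\wedge \mathrm{d}t$ is a formal marker for the second summand, and $\mathrm{d},\wedge,\delta,\Delta$ act pointwise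 in $t$. For $\xi\in F^n\otimes C^\infty(\mathbb{R})$, $\eta\in F^m\otimes C^\infty(\mathbb{R})$: $\mathrm{d}_\alpha(\xi)=\mathrm{d}\xi+(-1)^n\frac{\partial\xi}{\partial t}\wedge \mathrm{d}t+(-1)^n\alpha\Delta(\xi)\wedge \mathrm{d}t$; $\mathrm{d}_\alpha(\xi\wedge \mathrm{d}t)=\mathrm{d}\xi\wedge \mathrm{d}t$; $\xi\wedge_\alpha\eta=\xi\wedge\eta-(-1)^{n+m}\alpha(\delta(\xi\wedge\eta)-\delta(\xi)\wedge\eta-(-1)^n\xi\wedge\delta(\eta))\wedge \mathrm{d}t$; $(\xi\wedge \mathrm{d}t)\wedge_\alpha\eta=(-1)^m(\xi\wedge\eta)\wedge \mathrm{d}t$; $\xi\wedge_\alpha(\eta\wedge \mathrm{d}t)=(\xi\wedge\eta)\wedge \mathrm{d}t$; $(\xi\wedge \mathrm{d}t)\wedge_\alpha(\eta\wedge \mathrm{d}t)=0$. These make $F_{\mathbb{R}}^*$ a DGA for every $\alpha\in\mathbb{R}$. Its cohomology is $H^n(F_{\mathbb{R}}^*,\mathrm{d}_\alpha)=\ker(\mathrm{d}_\alpha:F_{\mathbb{R}}^n\to F_{\mathbb{R}}^{n+1})/\mathrm{im}(\mathrm{d}_\alpha:F_{\mathbb{R}}^{n-1}\to F_{\mathbb{R}}^n)$, with the product induced by $\wedge_\alpha$. *)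

theory Defs
  imports "HOL-Analysis.Analysis" "HOL-Library.Function_Algebras"
begin

text \<open>
  The ground field is a type of class \<open>real_normed_field\<close>. The norm of such a field is
  multiplicative, so by the Gelfand--Mazur theorem it is a copy of the real or of the complex numbers.

  Graded objects are indexed by \<open>int\<close> (zero in negative degrees). The components
  \<open>F n\<close> are subspaces of one ambient vector space, which serves only as a common type: the
  \<open>F n\<close> need be neither independent nor disjoint, and all operations carry their degrees as
  arguments and are constrained only on the \<open>F n\<close>.
\<close>

definition linear_on ::
  "('k::field \<Rightarrow> 'v::ab_group_add \<Rightarrow> 'v) \<Rightarrow> ('k \<Rightarrow> 'w::ab_group_add \<Rightarrow> 'w) \<Rightarrow>
    'v set \<Rightarrow> 'w set \<Rightarrow> ('v \<Rightarrow> 'w) \<Rightarrow> bool" where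
  "linear_on smul smul' V W f \<longleftrightarrow>
     (\<forall>x\<in>V. f x \<in> W) \<and>
     (\<forall>x\<in>V. \<forall>y\<in>V. f (x + y) = f x + f y) \<and>
     (\<forall>c. \<forall>x\<in>V. f (smul c x) = smul' c (f x))"

locale dga = vector_space smul
  for smul :: "'k::field \<Rightarrow> 'v::ab_group_add \<Rightarrow> 'v" +
  fixes F :: "int \<Rightarrow> 'v set"
    and d :: "int \<Rightarrow> 'v \<Rightarrow> 'v"
    and w :: "int \<Rightarrow> int \<Rightarrow> 'v \<Rightarrow> 'v \<Rightarrow> 'v"
  assumes subspace_F: "subspace (F n)"
    and F_negative: "n < 0 \<Longrightarrow> F n = {0}"
    and d_linear: "linear_on smul smul (F n) (F (n + 1)) (d n)"
    and w_linear_left: "y \<in> F m \<Longrightarrow> linear_on smul smul (F n) (F (n + m)) (\<lambda>x. w n m x y)"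
    and w_linear_right: "x \<in> F n \<Longrightarrow> linear_on smul smul (F m) (F (n + m)) (w n m x)"
    and w_assoc: "\<lbrakk>x \<in> F n; y \<in> F m; z \<in> F p\<rbrakk> \<Longrightarrow>
      w (n + m) p (w n m x y) z = w n (m + p) x (w m p y z)"
    and d_d: "x \<in> F n \<Longrightarrow> d (n + 1) (d n x) = 0"
    and d_w: "\<lbrakk>x \<in> F n; y \<in> F m\<rbrakk> \<Longrightarrow>
      d (n + m) (w n m x y) =
        w (n + 1) m (d n x) y + smul ((- 1) powi n) (w n (m + 1) x (d m y))"

section \<open>Cohomology algebras\<close>

definition cocycles :: "(int \<Rightarrow> 'v::ab_group_add set) \<Rightarrow> (int \<Rightarrow> 'v \<Rightarrow> 'v) \<Rightarrow> int \<Rightarrow> 'v set" where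
  "cocycles F d n = {x \<in> F n. d n x = 0}"

definition coboundaries :: "(int \<Rightarrow> 'v::ab_group_add set) \<Rightarrow> (int \<Rightarrow> 'v \<Rightarrow> 'v) \<Rightarrow> int \<Rightarrow> 'v set" where
  "coboundaries F d n = d (n - 1) ` F (n - 1)"

definition coh_class ::
  "(int \<Rightarrow> 'v::ab_group_add set) \<Rightarrow> (int \<Rightarrow> 'v \<Rightarrow> 'v) \<Rightarrow> int \<Rightarrow> 'v \<Rightarrow> 'v set" where
  "coh_class F d n x = (\<lambda>b. x + b) ` coboundaries F d n"

definition cohomology ::
  "(int \<Rightarrow> 'v::ab_group_add set) \<Rightarrow> (int \<Rightarrow> 'v \<Rightarrow> 'v) \<Rightarrow> int \<Rightarrow> 'v set set" where
  "cohomology F d n = coh_class F d n ` cocycles F d n"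

text \<open>
  The operations induced on cosets. As usual for quotients, the union over all representatives
  is a union of equal cosets whenever the operation is well defined on classes.
\<close>

definition coh_add ::
  "(int \<Rightarrow> 'v::ab_group_add set) \<Rightarrow> (int \<Rightarrow> 'v \<Rightarrow> 'v) \<Rightarrow> int \<Rightarrow> 'v set \<Rightarrow> 'v set \<Rightarrow> 'v set" where
  "coh_add F d n X Y = (\<Union>x\<in>X. \<Union>y\<in>Y. coh_class F d n (x + y))"

definition coh_scale ::
  "('k \<Rightarrow> 'v::ab_group_add \<Rightarrow> 'v) \<Rightarrow> (int \<Rightarrow> 'v set) \<Rightarrow> (int \<Rightarrow> 'v \<Rightarrow> 'v) \<Rightarrow>
    int \<Rightarrow> 'k \<Rightarrow> 'v set \<Rightarrow> 'v set" where
  "coh_scale smul F d n c X = (\<Union>x\<in>X. coh_class F d n (smul c x))"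

definition coh_mult ::
  "(int \<Rightarrow> 'v::ab_group_add set) \<Rightarrow> (int \<Rightarrow> 'v \<Rightarrow> 'v) \<Rightarrow>
    (int \<Rightarrow> int \<Rightarrow> 'v \<Rightarrow> 'v \<Rightarrow> 'v) \<Rightarrow> int \<Rightarrow> int \<Rightarrow> 'v set \<Rightarrow> 'v set \<Rightarrow> 'v set" where
  "coh_mult F d w n m X Y = (\<Union>x\<in>X. \<Union>y\<in>Y. coh_class F d (n + m) (w n m x y))"

text \<open>Isomorphism of the cohomologies as graded algebras.\<close>

definition cohomology_isomorphic ::
  "('k \<Rightarrow> 'v::ab_group_add \<Rightarrow> 'v) \<Rightarrow> (int \<Rightarrow> 'v set) \<Rightarrow> (int \<Rightarrow> 'v \<Rightarrow> 'v) \<Rightarrow>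
    (int \<Rightarrow> int \<Rightarrow> 'v \<Rightarrow> 'v \<Rightarrow> 'v) \<Rightarrow>
   ('k \<Rightarrow> 'u::ab_group_add \<Rightarrow> 'u) \<Rightarrow> (int \<Rightarrow> 'u set) \<Rightarrow> (int \<Rightarrow> 'u \<Rightarrow> 'u) \<Rightarrow>
    (int \<Rightarrow> int \<Rightarrow> 'u \<Rightarrow> 'u \<Rightarrow> 'u) \<Rightarrow> bool" where
  "cohomology_isomorphic smul F d w smul' F' d' w' \<longleftrightarrow>
    (\<exists>\<phi> :: int \<Rightarrow> 'v set \<Rightarrow> 'u set.
      (\<forall>n. bij_betw (\<phi> n) (cohomology F d n) (cohomology F' d' n)) \<and>
      (\<forall>n. \<forall>X\<in>cohomology F d n. \<forall>Y\<in>cohomology F d n.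
         \<phi> n (coh_add F d n X Y) = coh_add F' d' n (\<phi> n X) (\<phi> n Y)) \<and>
      (\<forall>n c. \<forall>X\<in>cohomology F d n.
         \<phi> n (coh_scale smul F d n c X) = coh_scale smul' F' d' n c (\<phi> n X)) \<and>
      (\<forall>n m. \<forall>X\<in>cohomology F d n. \<forall>Y\<in>cohomology F d m.
         \<phi> (n + m) (coh_mult F d w n m X Y) = coh_mult F' d' w' n m (\<phi> n X) (\<phi> m Y)))"

section \<open>The tensor product of a vector space with the smooth functions\<close>

definition smooth :: "(real \<Rightarrow> 'k::real_normed_vector) \<Rightarrow> bool" where
  "smooth g \<longleftrightarrow> (\<forall>k t. ((\<lambda>h s. vector_derivative h (at s)) ^^ k) g differentiable (at t))"

text \<open>
  The algebraic tensor product of \<open>V\<close> with the smooth functions is realised inside the functions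
  of time with values in \<open>V\<close>, the pure tensor of \<open>v\<close> and \<open>g\<close> being the function mapping \<open>t\<close> to
  \<open>g t\<close> times \<open>v\<close>; the lemma \<open>smooth_tensor_universal\<close> below is its universal property.
\<close>

definition fun_scale :: "('k \<Rightarrow> 'v \<Rightarrow> 'v) \<Rightarrow> 'k \<Rightarrow> (real \<Rightarrow> 'v) \<Rightarrow> (real \<Rightarrow> 'v)" where
  "fun_scale smul c \<xi> = (\<lambda>t. smul c (\<xi> t))"

definition pure_tensor :: "('k \<Rightarrow> 'v \<Rightarrow> 'v) \<Rightarrow> 'v \<Rightarrow> (real \<Rightarrow> 'k) \<Rightarrow> (real \<Rightarrow> 'v)" where
  "pure_tensor smul v g = (\<lambda>t. smul (g t) v)"

definition smooth_tensor ::
  "('k::real_normed_field \<Rightarrow> 'v::ab_group_add \<Rightarrow> 'v) \<Rightarrow> 'v set \<Rightarrow> (real \<Rightarrow> 'v) set" where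
  "smooth_tensor smul V =
     module.span (fun_scale smul) {pure_tensor smul v g | v g. v \<in> V \<and> smooth g}"

text \<open>
  The time derivative maps the tensor of \<open>v\<close> and \<open>g\<close> to the tensor of \<open>v\<close> and the derivative
  of \<open>g\<close>. Since \<open>'v\<close> has no topology, it is specified on sums of pure tensors;
  \<open>time_deriv_eqI\<close> shows that the result does not depend on the representation as such a sum.
\<close>

inductive has_time_deriv ::
  "('k::real_normed_field \<Rightarrow> 'v::ab_group_add \<Rightarrow> 'v) \<Rightarrow> (real \<Rightarrow> 'v) \<Rightarrow> (real \<Rightarrow> 'v) \<Rightarrow> bool"
  for smul where
  zero: "has_time_deriv smul 0 0"
| add_pure: "\<lbrakk>has_time_deriv smul \<xi> \<eta>; smooth g\<rbrakk> \<Longrightarrow>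
    has_time_deriv smul (\<xi> + pure_tensor smul v g)
      (\<eta> + pure_tensor smul v (\<lambda>t. vector_derivative g (at t)))"

definition time_deriv ::
  "('k::real_normed_field \<Rightarrow> 'v::ab_group_add \<Rightarrow> 'v) \<Rightarrow> (real \<Rightarrow> 'v) \<Rightarrow> (real \<Rightarrow> 'v)" where
  "time_deriv smul \<xi> = (THE \<eta>. has_time_deriv smul \<xi> \<eta>)"

section \<open>The homotopy deformation\<close>

text \<open>A pair \<open>(\<xi>, \<omega>)\<close> stands for \<open>\<xi> + \<omega> \<and> dt\<close>.\<close>

type_synonym 'v path_form = "(real \<Rightarrow> 'v) \<times> (real \<Rightarrow> 'v)"

definition path_scale ::
  "('k \<Rightarrow> 'v \<Rightarrow> 'v) \<Rightarrow> 'k \<Rightarrow> 'v path_form \<Rightarrow> 'v path_form" where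
  "path_scale smul c = (\<lambda>(\<xi>, \<omega>). (fun_scale smul c \<xi>, fun_scale smul c \<omega>))"

definition path_space ::
  "('k::real_normed_field \<Rightarrow> 'v::ab_group_add \<Rightarrow> 'v) \<Rightarrow> (int \<Rightarrow> 'v set) \<Rightarrow> int \<Rightarrow> 'v path_form set" where
  "path_space smul F n = smooth_tensor smul (F n) \<times> smooth_tensor smul (F (n - 1))"

definition laplacian ::
  "(int \<Rightarrow> 'v::ab_group_add \<Rightarrow> 'v) \<Rightarrow> (int \<Rightarrow> 'v \<Rightarrow> 'v) \<Rightarrow> int \<Rightarrow> 'v \<Rightarrow> 'v" where
  "laplacian d \<delta> n x = \<delta> (n + 1) (d n x) + d (n - 1) (\<delta> n x)"

definition path_d ::
  "('k::real_normed_field \<Rightarrow> 'v::ab_group_add \<Rightarrow> 'v) \<Rightarrow> (int \<Rightarrow> 'v \<Rightarrow> 'v) \<Rightarrow> (int \<Rightarrow> 'v \<Rightarrow> 'v) \<Rightarrow>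
    real \<Rightarrow> int \<Rightarrow> 'v path_form \<Rightarrow> 'v path_form" where
  "path_d smul d \<delta> \<alpha> n = (\<lambda>(\<xi>, \<omega>).
     ((\<lambda>t. d n (\<xi> t)),
      (\<lambda>t. smul ((- 1) powi n) (time_deriv smul \<xi> t)
           + smul ((- 1) powi n * of_real \<alpha>) (laplacian d \<delta> n (\<xi> t))
           + d (n - 1) (\<omega> t))))"

text \<open>
  In degrees \<open>n\<close> and \<open>m\<close> the coefficients \<open>\<omega>\<close> and \<open>\<zeta>\<close> of \<open>dt\<close> have degrees
  \<open>n - 1\<close> and \<open>m - 1\<close>.
\<close>

definition path_wedge ::
  "('k::real_normed_field \<Rightarrow> 'v::ab_group_add \<Rightarrow> 'v) \<Rightarrow> (int \<Rightarrow> int \<Rightarrow> 'v \<Rightarrow> 'v \<Rightarrow> 'v) \<Rightarrow>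
    (int \<Rightarrow> 'v \<Rightarrow> 'v) \<Rightarrow> real \<Rightarrow> int \<Rightarrow> int \<Rightarrow> 'v path_form \<Rightarrow> 'v path_form \<Rightarrow> 'v path_form" where
  "path_wedge smul w \<delta> \<alpha> n m = (\<lambda>(\<xi>, \<omega>) (\<eta>, \<zeta>).
     ((\<lambda>t. w n m (\<xi> t) (\<eta> t)),
      (\<lambda>t. - smul ((- 1) powi (n + m) * of_real \<alpha>)
               (\<delta> (n + m) (w n m (\<xi> t) (\<eta> t))
                - w (n - 1) m (\<delta> n (\<xi> t)) (\<eta> t)
                - smul ((- 1) powi n) (w n (m - 1) (\<xi> t) (\<delta> m (\<eta> t))))
           + smul ((- 1) powi m) (w (n - 1) m (\<omega> t) (\<eta> t))
           + w n (m - 1) (\<xi> t) (\<zeta> t))))"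

section \<open>Well-definedness of the tensor product and of the time derivative\<close>

lemma linear_on_add: "\<lbrakk>linear_on smul smul' V W f; x \<in> V; y \<in> V\<rbrakk> \<Longrightarrow> f (x + y) = f x + f y"
  unfolding linear_on_def by blast

lemma linear_on_scale: "\<lbrakk>linear_on smul smul' V W f; x \<in> V\<rbrakk> \<Longrightarrow> f (smul c x) = smul' c (f x)"
  unfolding linear_on_def by blast

lemma linear_on_zero: "\<lbrakk>linear_on smul smul' V W f; 0 \<in> V\<rbrakk> \<Longrightarrow> f 0 = 0"
  using linear_on_add[of smul smul' V W f 0 0] by simp

lemma smooth_differentiable: "smooth g \<Longrightarrow> g differentiable (at t)"
  unfolding smooth_def by (metis funpow_0)

lemma smooth_coinduct:
  assumes "g \<in> S"
    and "\<And>h t. h \<in> S \<Longrightarrow> h differentiable (at t)"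
    and "\<And>h. h \<in> S \<Longrightarrow> (\<lambda>s. vector_derivative h (at s)) \<in> S"
  shows "smooth g"
proof -
  have "((\<lambda>h s. vector_derivative h (at s)) ^^ k) g \<in> S" for k
    by (induction k) (auto simp: assms)
  then show ?thesis
    unfolding smooth_def using assms(2) by blast
qed

lemma smooth_vector_derivative: "smooth g \<Longrightarrow> smooth (\<lambda>s. vector_derivative g (at s))"
  unfolding smooth_def by (metis (mono_tags, lifting) funpow_Suc_right o_apply)

lemma smooth_const: "smooth (\<lambda>t. c)"
  by (rule smooth_coinduct[where S = "range (\<lambda>c t. c)"]) auto

lemma smooth_add:
  fixes g h :: "real \<Rightarrow> 'k::real_normed_vector"
  assumes "smooth g" "smooth h"
  shows "smooth (\<lambda>t. g t + h t)"
proof (rule smooth_coinduct[where S = "{\<lambda>t. g t + h t | g h. smooth g \<and> smooth h}"])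
  fix f :: "real \<Rightarrow> 'k" assume "f \<in> {\<lambda>t. g t + h t | g h. smooth g \<and> smooth h}"
  then obtain g h where f: "f = (\<lambda>t. g t + h t)" and gh: "smooth g" "smooth h" by blast
  show "f differentiable (at t)" for t
    unfolding f using gh by (simp add: smooth_differentiable)
  have "(\<lambda>s. vector_derivative f (at s)) =
      (\<lambda>s. vector_derivative g (at s) + vector_derivative h (at s))"
    unfolding f using gh by (simp add: smooth_differentiable)
  then show "(\<lambda>s. vector_derivative f (at s)) \<in> {\<lambda>t. g t + h t | g h. smooth g \<and> smooth h}"
    using gh[THEN smooth_vector_derivative] by (intro CollectI exI conjI)
next
  show "(\<lambda>t. g t + h t) \<in> {\<lambda>t. g t + h t | g h. smooth g \<and> smooth h}"
    by (rule CollectI, rule exI[of _ g], rule exI[of _ h]) (simp add: assms)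
qed

lemma smooth_cmult:
  fixes g :: "real \<Rightarrow> 'k::real_normed_field"
  assumes "smooth g"
  shows "smooth (\<lambda>t. c * g t)"
proof (rule smooth_coinduct[where S = "{\<lambda>t. c * g t | g. smooth g}"])
  fix f :: "real \<Rightarrow> 'k" assume "f \<in> {\<lambda>t. c * g t | g. smooth g}"
  then obtain g where f: "f = (\<lambda>t. c * g t)" and g: "smooth g" by blast
  have D: "(f has_vector_derivative c * vector_derivative g (at s)) (at s)" for s
    unfolding f using g
    by (intro has_vector_derivative_mult_right)
       (simp add: smooth_differentiable vector_derivative_works[symmetric])
  show "f differentiable (at t)" for t
    by (rule differentiableI_vector[OF D])
  have "(\<lambda>s. vector_derivative f (at s)) = (\<lambda>s. c * vector_derivative g (at s))"
    by (rule ext) (rule vector_derivative_at[OF D])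
  then show "(\<lambda>s. vector_derivative f (at s)) \<in> {\<lambda>t. c * g t | g. smooth g}"
    using smooth_vector_derivative[OF g] by (intro CollectI exI conjI)
next
  show "(\<lambda>t. c * g t) \<in> {\<lambda>t. c * g t | g. smooth g}"
    by (rule CollectI, rule exI[of _ g]) (simp add: assms)
qed

lemma vector_space_fun_scale: "vector_space smul \<Longrightarrow> vector_space (fun_scale smul)"
  unfolding vector_space_def fun_scale_def by (simp add: fun_eq_iff)

lemma vector_space_path_scale: "vector_space smul \<Longrightarrow> vector_space (path_scale smul)"
  unfolding vector_space_def path_scale_def fun_scale_def
  by (simp add: fun_eq_iff split: prod.split)

lemma smooth_tensor_induct [consumes 2, case_names zero add_pure]:
  assumes "vector_space smul" "\<xi> \<in> smooth_tensor smul V"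
    and "P 0"
    and "\<And>\<xi> v g. \<lbrakk>\<xi> \<in> smooth_tensor smul V; P \<xi>; v \<in> V; smooth g\<rbrakk> \<Longrightarrow>
      P (\<xi> + pure_tensor smul v g)"
  shows "P \<xi>"
proof -
  interpret vector_space smul by fact
  interpret T: vector_space "fun_scale smul" by (rule vector_space_fun_scale) fact
  from assms(2) have "\<xi> \<in> smooth_tensor smul V \<and> P \<xi>"
    unfolding smooth_tensor_def
  proof (induction rule: T.span_induct_alt)
    case base
    show ?case using assms(3) T.span_zero by blast
  next
    case (step c x y)
    from step(1) obtain v g where x: "x = pure_tensor smul v g" and vg: "v \<in> V" "smooth g"
      by blast
    have "fun_scale smul c x + y = y + pure_tensor smul v (\<lambda>t. c * g t)"
      unfolding x fun_scale_def pure_tensor_def by (simp add: fun_eq_iff)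
    moreover have c: "smooth (\<lambda>t. c * g t)" by (rule smooth_cmult) fact
    moreover have "P (y + pure_tensor smul v (\<lambda>t. c * g t))"
      using assms(4)[of y v] step(2) vg c unfolding smooth_tensor_def by blast
    moreover have "y + pure_tensor smul v (\<lambda>t. c * g t)
        \<in> T.span {pure_tensor smul v g | v g. v \<in> V \<and> smooth g}"
      by (rule T.span_add[OF conjunct1[OF step(2)] T.span_base]) (use vg c in blast)
    ultimately show ?case by (simp only: simp_thms)
  qed
  then show ?thesis by blast
qed

lemma has_time_deriv_functional:
  assumes "vector_space smul" "Vector_Spaces.linear smul (*) f" "has_time_deriv smul \<xi> \<eta>"
  shows "((\<lambda>t. f (\<xi> t)) has_vector_derivative f (\<eta> t)) (at t)"
  using assms(3)
proof induction
  interpret f: Vector_Spaces.linear smul "(*)" f by fact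
  case zero
  show ?case by (simp add: f.zero)
next
  interpret f: Vector_Spaces.linear smul "(*)" f by fact
  case (add_pure \<xi> \<eta> g v)
  have "(g has_vector_derivative vector_derivative g (at t)) (at t)"
    using smooth_differentiable[OF add_pure(2)] vector_derivative_works by blast
  then have "((\<lambda>t. g t * f v) has_vector_derivative vector_derivative g (at t) * f v) (at t)"
    by (rule has_vector_derivative_mult_left)
  from has_vector_derivative_add[OF add_pure(3) this] show ?case
    by (simp add: pure_tensor_def f.add f.scale)
qed

lemma has_time_deriv_unique:
  assumes "vector_space smul" "has_time_deriv smul \<xi> \<eta>" "has_time_deriv smul \<xi> \<eta>'"
  shows "\<eta> = \<eta>'"
proof
  fix t
  interpret vector_space smul by fact
  obtain B where B: "independent B" "span B = UNIV"
    by (meson basis_exists top.extremum_uniqueI)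
  have "representation B (\<eta> t) b = representation B (\<eta>' t) b" for b
    using has_time_deriv_functional[OF assms(1) linear_representation[OF B] assms(2)]
      has_time_deriv_functional[OF assms(1) linear_representation[OF B] assms(3)]
      vector_derivative_unique_at by blast
  then have "representation B (\<eta> t) = representation B (\<eta>' t)" by blast
  moreover have "(\<Sum>b | representation B x b \<noteq> 0. smul (representation B x b) b) = x" for x
    by (rule sum_nonzero_representation_eq) (use B in auto)
  ultimately show "\<eta> t = \<eta>' t" by metis
qed

lemma time_deriv_eqI:
  "\<lbrakk>vector_space smul; has_time_deriv smul \<xi> \<eta>\<rbrakk> \<Longrightarrow> time_deriv smul \<xi> = \<eta>"
  unfolding time_deriv_def using has_time_deriv_unique by blast

lemma has_time_deriv_time_deriv:
  assumes "vector_space smul" "\<xi> \<in> smooth_tensor smul V"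
  shows "has_time_deriv smul \<xi> (time_deriv smul \<xi>)"
proof -
  from assms have "\<exists>\<eta>. has_time_deriv smul \<xi> \<eta>"
    by (induction rule: smooth_tensor_induct) (blast intro: has_time_deriv.intros)+
  then show ?thesis using time_deriv_eqI[OF assms(1)] by metis
qed

lemma smooth_tensor_universal:
  fixes smul :: "'k::real_normed_field \<Rightarrow> 'v::ab_group_add \<Rightarrow> 'v"
    and smul' :: "'k \<Rightarrow> 'w::ab_group_add \<Rightarrow> 'w"
    and B :: "'v \<Rightarrow> (real \<Rightarrow> 'k) \<Rightarrow> 'w"
  assumes "vector_space smul" "vector_space smul'" and V: "module.subspace smul V"
    and B1: "\<And>g. smooth g \<Longrightarrow> linear_on smul smul' V UNIV (\<lambda>v. B v g)"
    and B2: "\<And>v. v \<in> V \<Longrightarrow> linear_on (\<lambda>c g t. c * g t) smul' {g. smooth g} UNIV (B v)"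
  shows "\<exists>L. linear_on (fun_scale smul) smul' (smooth_tensor smul V) UNIV L \<and>
    (\<forall>v\<in>V. \<forall>g. smooth g \<longrightarrow> L (pure_tensor smul v g) = B v g)"
proof -
  interpret vector_space smul by fact
  interpret W: vector_space smul' by fact
  obtain E where E: "E \<subseteq> V" "independent E" "V \<subseteq> span E" by (meson basis_exists)
  have EV: "span E = V" using E(1,3) V span_minimal by blast
  define r where "r \<xi> b t = representation E (\<xi> t) b" for \<xi> :: "real \<Rightarrow> 'v" and b t
  define supp where "supp \<xi> = {b. r \<xi> b \<noteq> (\<lambda>t. 0)}" for \<xi>
  define L where "L \<xi> = (\<Sum>b\<in>supp \<xi>. B b (r \<xi> b))" for \<xi>
  have B0: "B b (\<lambda>t. 0) = 0" if "b \<in> V" for b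
    using linear_on_zero[OF B2[OF that]] smooth_const[of 0] by (simp add: zero_fun_def)
  have r_pure: "r (pure_tensor smul v g) b t = representation E v b * g t" if "v \<in> V" for v g b t
    using that E EV by (simp add: r_def pure_tensor_def representation_scale)
  have r_pure': "r (pure_tensor smul v g) b = (\<lambda>t. representation E v b * g t)"
    if "v \<in> V" for v g b
    using r_pure[OF that] by blast
  have val: "\<xi> t \<in> V" if "\<xi> \<in> smooth_tensor smul V" for \<xi> t
    using \<open>vector_space smul\<close> that
  proof (induction rule: smooth_tensor_induct)
    case zero
    then show ?case using subspace_0[OF V] by simp
  next
    case (add_pure \<xi> v g)
    then show ?case
      using subspace_add[OF V] subspace_scale[OF V] by (simp add: pure_tensor_def)
  qed
  have r_add: "r (\<xi> + \<eta>) b = (\<lambda>t. r \<xi> b t + r \<eta> b t)"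
    if "\<And>t. \<xi> t \<in> V" "\<And>t. \<eta> t \<in> V" for \<xi> \<eta> b
    using that E EV by (simp add: r_def fun_eq_iff representation_add)
  have pure_val: "pure_tensor smul v g t \<in> V" if "v \<in> V" for v g t
    using that subspace_scale[OF V] by (simp add: pure_tensor_def)
  have fin_pure: "finite (supp (pure_tensor smul v g))" if "v \<in> V" for v g
    by (rule finite_subset[OF _ finite_representation[of E v]])
       (auto simp: supp_def r_pure'[OF that])
  have key: "(\<forall>b. smooth (r \<xi> b)) \<and> finite (supp \<xi>)" if "\<xi> \<in> smooth_tensor smul V" for \<xi>
    using \<open>vector_space smul\<close> that
  proof (induction rule: smooth_tensor_induct)
    case zero
    have r0: "r 0 b = (\<lambda>t. 0)" for b
      unfolding r_def by (rule ext) (simp only: zero_fun_apply representation_zero)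
    show ?case unfolding supp_def r0 by (simp add: smooth_const)
  next
    case (add_pure \<xi> v g)
    have eq: "r (\<xi> + pure_tensor smul v g) b = (\<lambda>t. r \<xi> b t + r (pure_tensor smul v g) b t)" for b
      by (rule r_add[OF val[OF \<open>\<xi> \<in> smooth_tensor smul V\<close>] pure_val[OF \<open>v \<in> V\<close>]])
    have "smooth (r (\<xi> + pure_tensor smul v g) b)" for b
      unfolding eq r_pure'[OF \<open>v \<in> V\<close>]
      by (rule smooth_add[OF _ smooth_cmult[OF \<open>smooth g\<close>]]) (use add_pure in blast)
    moreover have "supp (\<xi> + pure_tensor smul v g) \<subseteq> supp \<xi> \<union> supp (pure_tensor smul v g)"
      unfolding supp_def eq by auto
    ultimately show ?case
      using add_pure fin_pure[OF \<open>v \<in> V\<close>, of g] by (meson finite_UnI finite_subset)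
  qed
  have rE: "r \<xi> b = (\<lambda>t. 0)" if "b \<notin> E" for \<xi> b
    using that by (auto simp: r_def fun_eq_iff dest: representation_ne_zero)
  have suppE: "supp \<xi> \<subseteq> V" for \<xi>
    using rE E(1) by (auto simp: supp_def)
  have L_eq: "L \<xi> = (\<Sum>b\<in>A. B b (r \<xi> b))" if "finite A" "supp \<xi> \<subseteq> A" "A \<subseteq> V" for \<xi> A
    unfolding L_def by (rule sum.mono_neutral_left) (use that B0 in \<open>auto simp: supp_def\<close>)
  interpret T: vector_space "fun_scale smul" by (rule vector_space_fun_scale) fact
  have add_in: "\<xi> + \<eta> \<in> smooth_tensor smul V"
    if "\<xi> \<in> smooth_tensor smul V" "\<eta> \<in> smooth_tensor smul V" for \<xi> \<eta>
    using that T.span_add unfolding smooth_tensor_def by blast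
  have scale_in: "fun_scale smul c \<xi> \<in> smooth_tensor smul V"
    if "\<xi> \<in> smooth_tensor smul V" for \<xi> c
    using that T.span_scale unfolding smooth_tensor_def by blast
  have L_add: "L (\<xi> + \<eta>) = L \<xi> + L \<eta>"
    if *: "\<xi> \<in> smooth_tensor smul V" "\<eta> \<in> smooth_tensor smul V" for \<xi> \<eta>
  proof -
    let ?A = "supp \<xi> \<union> supp \<eta> \<union> supp (\<xi> + \<eta>)"
    have A: "finite ?A" "?A \<subseteq> V" using key[OF *(1)] key[OF *(2)] key[OF add_in[OF *]] suppE by auto
    have "B b (r (\<xi> + \<eta>) b) = B b (r \<xi> b) + B b (r \<eta> b)" if "b \<in> ?A" for b
    proof -
      have "r (\<xi> + \<eta>) b = r \<xi> b + r \<eta> b"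
        using r_add[of \<xi> \<eta> b] val * by (auto simp: fun_eq_iff)
      then show ?thesis
        using linear_on_add[OF B2, of b "r \<xi> b" "r \<eta> b"] that A(2) key[OF *(1)] key[OF *(2)]
        by (metis mem_Collect_eq subsetD)
    qed
    then have "(\<Sum>b\<in>?A. B b (r (\<xi> + \<eta>) b)) = (\<Sum>b\<in>?A. B b (r \<xi> b)) + (\<Sum>b\<in>?A. B b (r \<eta> b))"
      unfolding sum.distrib[symmetric] by (rule sum.cong[OF refl])
    moreover have "L \<xi> = (\<Sum>b\<in>?A. B b (r \<xi> b))" "L \<eta> = (\<Sum>b\<in>?A. B b (r \<eta> b))"
      "L (\<xi> + \<eta>) = (\<Sum>b\<in>?A. B b (r (\<xi> + \<eta>) b))"
      by (rule L_eq[OF A(1) _ A(2)], blast)+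
    ultimately show ?thesis by metis
  qed
  have L_scale: "L (fun_scale smul c \<xi>) = smul' c (L \<xi>)"
    if *: "\<xi> \<in> smooth_tensor smul V" for c \<xi>
  proof -
    let ?A = "supp \<xi> \<union> supp (fun_scale smul c \<xi>)"
    have A: "finite ?A" "?A \<subseteq> V" using key[OF *] key[OF scale_in[OF *]] suppE by auto
    have "B b (r (fun_scale smul c \<xi>) b) = smul' c (B b (r \<xi> b))" if "b \<in> ?A" for b
    proof -
      have "r (fun_scale smul c \<xi>) b = (\<lambda>t. c * r \<xi> b t)"
        using val[OF *] E EV by (simp add: r_def fun_eq_iff fun_scale_def representation_scale)
      then show ?thesis
        using linear_on_scale[OF B2, of b "r \<xi> b" c] that A(2) key[OF *]
        by (metis mem_Collect_eq subsetD)
    qed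
    then have "(\<Sum>b\<in>?A. B b (r (fun_scale smul c \<xi>) b)) = smul' c (\<Sum>b\<in>?A. B b (r \<xi> b))"
      unfolding W.scale_sum_right by (rule sum.cong[OF refl])
    moreover have "L \<xi> = (\<Sum>b\<in>?A. B b (r \<xi> b))"
      "L (fun_scale smul c \<xi>) = (\<Sum>b\<in>?A. B b (r (fun_scale smul c \<xi>) b))"
      by (rule L_eq[OF A(1) _ A(2)], blast)+
    ultimately show ?thesis by metis
  qed
  have L_pure: "L (pure_tensor smul v g) = B v g" if v: "v \<in> V" and g: "smooth g" for v g
  proof -
    let ?R = "{b. representation E v b \<noteq> 0}"
    have R: "finite ?R" "?R \<subseteq> V"
      using finite_representation representation_ne_zero E(1) by auto
    have lin: "B (\<Sum>b\<in>A. smul (c b) b) g = (\<Sum>b\<in>A. smul' (c b) (B b g))"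
      if "finite A" "A \<subseteq> V" for A c
      using that
    proof (induction A)
      case empty
      show ?case using linear_on_zero[OF B1[OF g] subspace_0[OF V]] by simp
    next
      case (insert a A)
      have "smul (c a) a \<in> V" "(\<Sum>b\<in>A. smul (c b) b) \<in> V"
        using insert.prems by (auto intro!: subspace_scale[OF V] subspace_sum[OF V])
      then show ?case
        using insert linear_on_add[OF B1[OF g]] linear_on_scale[OF B1[OF g]] by simp
    qed
    have "L (pure_tensor smul v g) = (\<Sum>b\<in>?R. B b (r (pure_tensor smul v g) b))"
      by (rule L_eq) (use R in \<open>auto simp: supp_def r_pure'[OF v]\<close>)
    also have "\<dots> = (\<Sum>b\<in>?R. smul' (representation E v b) (B b g))"
      unfolding r_pure'[OF v]
      by (rule sum.cong) (use R g linear_on_scale[OF B2] in auto)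
    also have "\<dots> = B (\<Sum>b\<in>?R. smul (representation E v b) b) g"
      using lin[OF R] by simp
    also have "\<dots> = B v g"
      using sum_nonzero_representation_eq[of E v] E EV v by simp
    finally show ?thesis .
  qed
  show ?thesis
    unfolding linear_on_def using L_add L_scale L_pure by blast
qed

end

theory Submission
  imports Defs
begin

text \<open>
  The two deformations are not merely quasi-isomorphic: they are isomorphic differential graded
  algebras, through the shear
    \<open>\<xi> + \<omega> \<and> dt \<mapsto> \<xi> + (\<omega> - (-1)\<^sup>n \<alpha> \<delta> \<xi>) \<and> dt\<close>  in degree \<open>n\<close>.
  Up to signs, the term \<open>\<alpha> \<Delta> \<xi>\<close> in \<open>d\<^sub>\<alpha>\<close> is the graded commutator of \<open>d\<close> with \<open>\<alpha> \<delta>\<close>, and the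
  \<open>\<alpha>\<close>-term of the product is the failure of \<open>\<alpha> \<delta>\<close> to be a graded derivation. Both are what
  transporting the undeformed structure along the shear produces; no higher powers of \<open>\<alpha>\<close> occur,
  since \<open>dt \<and> dt = 0\<close> (\<open>path_d_shear\<close>, \<open>path_wedge_shear\<close>). The inverse of the shear is the shear
  for \<open>- \<alpha>\<close>. The time derivative enters only through \<open>\<xi>\<close>, which the shear fixes.

  An isomorphism of differential graded algebras maps cosets of coboundaries to cosets of
  coboundaries and so gives an isomorphism of cohomology algebras
  (\<open>cohomology_isomorphic_if_dga_isomorphic\<close>). To apply this, the undeformed operations and the
  shear must preserve the spaces of smooth forms. The only analysis in that is the smoothness of
  products of smooth functions, needed for the wedge product.
\<close>

section \<open>Isomorphisms of differential graded algebras and cohomology\<close>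

text \<open>
  The isomorphism sends a class, which is a subset of \<open>F n\<close>, to its image under \<open>T\<close>. So it is enough
  that \<open>T\<close> maps cocycles onto cocycles and the coset of \<open>x\<close> onto the coset of \<open>T x\<close>; the induced
  operations are unions of cosets, and images commute with unions.
\<close>

lemma cohomology_isomorphic_if_dga_isomorphic:
  assumes zero: "\<And>n. 0 \<in> F n"
    and add: "\<And>n x y. \<lbrakk>x \<in> F n; y \<in> F n\<rbrakk> \<Longrightarrow> x + y \<in> F n"
    and scale: "\<And>n c x. x \<in> F n \<Longrightarrow> smul c x \<in> F n"
    and d: "\<And>n x. x \<in> F n \<Longrightarrow> d n x \<in> F (n + 1)"
    and w: "\<And>n m x y. \<lbrakk>x \<in> F n; y \<in> F m\<rbrakk> \<Longrightarrow> w n m x y \<in> F (n + m)"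
    and T_linear: "\<And>n. linear_on smul smul' (F n) (F' n) (T n)"
    and T_bij: "\<And>n. bij_betw (T n) (F n) (F' n)"
    and T_d: "\<And>n x. x \<in> F n \<Longrightarrow> T (n + 1) (d n x) = d' n (T n x)"
    and T_w: "\<And>n m x y. \<lbrakk>x \<in> F n; y \<in> F m\<rbrakk> \<Longrightarrow>
      T (n + m) (w n m x y) = w' n m (T n x) (T m y)"
  shows "cohomology_isomorphic smul F d w smul' F' d' w'"
proof -
  have T_add: "T n (x + y) = T n x + T n y" if "x \<in> F n" "y \<in> F n" for n x y
    using linear_on_add[OF T_linear that] .
  have T_zero: "T n 0 = 0" for n
    using linear_on_zero[OF T_linear zero] .
  have T_inj: "inj_on (T n) (F n)" and T_image: "T n ` F n = F' n" for n
    using T_bij unfolding bij_betw_def by auto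
  have bound_sub: "coboundaries F d n \<subseteq> F n" for n
    using d[of _ "n - 1"] by (auto simp: coboundaries_def)
  have bound_image: "T n ` coboundaries F d n = coboundaries F' d' n" for n
    using T_d[of _ "n - 1"] unfolding coboundaries_def T_image[symmetric] image_image
    by (auto intro!: image_cong)
  have class_sub: "coh_class F d n x \<subseteq> F n" if "x \<in> F n" for n x
    using that add subsetD[OF bound_sub] by (auto simp: coh_class_def)
  have class_image: "T n ` coh_class F d n x = coh_class F' d' n (T n x)" if "x \<in> F n" for n x
    using T_add[OF that subsetD[OF bound_sub]]
    unfolding coh_class_def bound_image[symmetric] image_image by (intro image_cong) auto
  have cocycles_image: "T n ` cocycles F d n = cocycles F' d' n" for n
  proof -
    have "d' n (T n x) = 0 \<longleftrightarrow> d n x = 0" if "x \<in> F n" for x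
      using inj_onD[OF T_inj _ d[OF that] zero] T_d[OF that] T_zero by metis
    then show ?thesis
      unfolding cocycles_def T_image[symmetric] by auto
  qed
  have cocycles_sub: "cocycles F d n \<subseteq> F n" for n
    by (auto simp: cocycles_def)
  have coh_sub: "X \<subseteq> F n" if "X \<in> cohomology F d n" for X n
    using that class_sub cocycles_sub by (fastforce simp: cohomology_def)
  have coh_image: "(`) (T n) ` cohomology F d n = cohomology F' d' n" for n
    unfolding cohomology_def cocycles_image[symmetric] image_image
    using class_image[OF subsetD[OF cocycles_sub]] by (intro image_cong refl)
  have "bij_betw ((`) (T n)) (cohomology F d n) (cohomology F' d' n)" for n
    unfolding bij_betw_def
    by (auto simp: coh_image intro!: inj_on_subset[OF inj_on_image_Pow[OF T_inj]] dest: coh_sub)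
  moreover have "T n ` coh_add F d n X Y = coh_add F' d' n (T n ` X) (T n ` Y)"
    if "X \<subseteq> F n" "Y \<subseteq> F n" for n X Y
  proof -
    have "T n ` coh_class F d n (x + y) = coh_class F' d' n (T n x + T n y)"
      if "x \<in> X" "y \<in> Y" for x y
      using that \<open>X \<subseteq> F n\<close> \<open>Y \<subseteq> F n\<close> by (metis T_add add class_image subsetD)
    then show ?thesis
      by (simp add: coh_add_def image_UN)
  qed
  moreover have "T n ` coh_scale smul F d n c X = coh_scale smul' F' d' n c (T n ` X)"
    if "X \<subseteq> F n" for n c X
  proof -
    have "T n ` coh_class F d n (smul c x) = coh_class F' d' n (smul' c (T n x))"
      if "x \<in> X" for x
      using that \<open>X \<subseteq> F n\<close> by (metis linear_on_scale[OF T_linear] scale class_image subsetD)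
    then show ?thesis
      by (simp add: coh_scale_def image_UN)
  qed
  moreover have "T (n + m) ` coh_mult F d w n m X Y = coh_mult F' d' w' n m (T n ` X) (T m ` Y)"
    if "X \<subseteq> F n" "Y \<subseteq> F m" for n m X Y
  proof -
    have "T (n + m) ` coh_class F d (n + m) (w n m x y) =
        coh_class F' d' (n + m) (w' n m (T n x) (T m y))"
      if "x \<in> X" "y \<in> Y" for x y
      using that \<open>X \<subseteq> F n\<close> \<open>Y \<subseteq> F m\<close> by (metis T_w w class_image subsetD)
    then show ?thesis
      by (simp add: coh_mult_def image_UN)
  qed
  ultimately show ?thesis
    unfolding cohomology_isomorphic_def
    by (intro exI[of _ "\<lambda>n. (`) (T n)"]) (simp add: coh_sub)
qed

section \<open>Smooth functions of time\<close>

text \<open>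
  The derivative of a product is not visibly a product, but by the Leibniz rule the finite sums of
  products are closed under differentiation, as the coinductive proof of \<open>smooth_mult\<close> requires.
\<close>

inductive_set product_sums :: "(real \<Rightarrow> 'k::real_normed_field) set" where
  mult: "\<lbrakk>smooth g; smooth h\<rbrakk> \<Longrightarrow> (\<lambda>t. g t * h t) \<in> product_sums"
| add: "\<lbrakk>f \<in> product_sums; f' \<in> product_sums\<rbrakk> \<Longrightarrow> (\<lambda>t. f t + f' t) \<in> product_sums"

lemma product_sums_derivative:
  assumes "f \<in> product_sums"
  shows "\<exists>D\<in>product_sums. \<forall>t. (f has_vector_derivative D t) (at t)"
  using assms
proof induction
  case (mult g h)
  let ?g' = "\<lambda>t. vector_derivative g (at t)" and ?h' = "\<lambda>t. vector_derivative h (at t)"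
  have "((\<lambda>t. g t * h t) has_vector_derivative g t * ?h' t + ?g' t * h t) (at t)" for t
    using mult[THEN smooth_differentiable, THEN vector_derivative_works[THEN iffD1]]
    by (rule has_vector_derivative_mult)
  moreover have "(\<lambda>t. g t * ?h' t + ?g' t * h t) \<in> product_sums"
    using mult by (intro product_sums.intros smooth_vector_derivative)
  ultimately show ?case
    by (intro bexI[of _ "\<lambda>t. g t * ?h' t + ?g' t * h t"]) auto
next
  case (add f f')
  then obtain D D' where "D \<in> product_sums" "D' \<in> product_sums"
    "\<And>t. (f has_vector_derivative D t) (at t)" "\<And>t. (f' has_vector_derivative D' t) (at t)"
    by blast
  then show ?case
    by (intro bexI[of _ "\<lambda>t. D t + D' t"]) (auto intro: product_sums.add has_vector_derivative_add)
qed

lemma smooth_mult: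
  fixes g h :: "real \<Rightarrow> 'k::real_normed_field"
  assumes "smooth g" "smooth h"
  shows "smooth (\<lambda>t. g t * h t)"
proof (rule smooth_coinduct[where S = product_sums])
  show "(\<lambda>t. g t * h t) \<in> product_sums"
    using assms by (rule product_sums.mult)
next
  fix f :: "real \<Rightarrow> 'k" assume "f \<in> product_sums"
  then obtain D where D: "D \<in> product_sums" "\<And>t. (f has_vector_derivative D t) (at t)"
    using product_sums_derivative by blast
  show "f differentiable (at t)" for t
    by (rule differentiableI_vector[OF D(2)])
  have "(\<lambda>s. vector_derivative f (at s)) = D"
    using vector_derivative_at[OF D(2)] by blast
  then show "(\<lambda>s. vector_derivative f (at s)) \<in> product_sums"
    using D(1) by simp
qed

section \<open>Smooth functions with values in a vector space\<close>

context
  fixes smul :: "'k::real_normed_field \<Rightarrow> 'v::ab_group_add \<Rightarrow> 'v"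
  assumes vs: "vector_space smul"
begin

lemma smooth_tensor_zero: "0 \<in> smooth_tensor smul V"
  and smooth_tensor_add:
    "\<lbrakk>\<xi> \<in> smooth_tensor smul V; \<eta> \<in> smooth_tensor smul V\<rbrakk> \<Longrightarrow> \<xi> + \<eta> \<in> smooth_tensor smul V"
  and smooth_tensor_scale:
    "\<xi> \<in> smooth_tensor smul V \<Longrightarrow> fun_scale smul c \<xi> \<in> smooth_tensor smul V"
  and smooth_tensor_pure:
    "\<lbrakk>v \<in> V; smooth g\<rbrakk> \<Longrightarrow> pure_tensor smul v g \<in> smooth_tensor smul V"
proof -
  interpret T: vector_space "fun_scale smul" by (rule vector_space_fun_scale[OF vs])
  show "0 \<in> smooth_tensor smul V"
    unfolding smooth_tensor_def by (rule T.span_zero)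
  show "\<lbrakk>\<xi> \<in> smooth_tensor smul V; \<eta> \<in> smooth_tensor smul V\<rbrakk> \<Longrightarrow> \<xi> + \<eta> \<in> smooth_tensor smul V"
    unfolding smooth_tensor_def by (rule T.span_add)
  show "\<xi> \<in> smooth_tensor smul V \<Longrightarrow> fun_scale smul c \<xi> \<in> smooth_tensor smul V"
    unfolding smooth_tensor_def by (rule T.span_scale)
  show "\<lbrakk>v \<in> V; smooth g\<rbrakk> \<Longrightarrow> pure_tensor smul v g \<in> smooth_tensor smul V"
    unfolding smooth_tensor_def by (rule T.span_base) blast
qed

lemma smooth_tensor_value:
  assumes "module.subspace smul V" "\<xi> \<in> smooth_tensor smul V"
  shows "\<xi> t \<in> V"
proof -
  interpret vector_space smul by (rule vs)
  show ?thesis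
    using vs assms(2)
    by (induction rule: smooth_tensor_induct)
       (simp_all add: pure_tensor_def subspace_0 subspace_add subspace_scale assms(1))
qed

lemma smooth_tensor_time_deriv:
  assumes "\<xi> \<in> smooth_tensor smul V"
  shows "time_deriv smul \<xi> \<in> smooth_tensor smul V"
proof -
  have "\<exists>\<eta>\<in>smooth_tensor smul V. has_time_deriv smul \<xi> \<eta>"
    using vs assms
  proof (induction rule: smooth_tensor_induct)
    case zero
    show ?case using smooth_tensor_zero has_time_deriv.zero by blast
  next
    case (add_pure \<xi> v g)
    then obtain \<eta> where \<eta>: "\<eta> \<in> smooth_tensor smul V" "has_time_deriv smul \<xi> \<eta>"
      by blast
    have "\<eta> + pure_tensor smul v (\<lambda>t. vector_derivative g (at t)) \<in> smooth_tensor smul V"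
      by (intro smooth_tensor_add smooth_tensor_pure smooth_vector_derivative \<eta>(1) add_pure(2,3))
    with has_time_deriv.add_pure[OF \<eta>(2) add_pure(3)] show ?case ..
  qed
  then show ?thesis using time_deriv_eqI[OF vs] by blast
qed

lemma smooth_tensor_linear_image:
  assumes V: "module.subspace smul V" and f: "linear_on smul smul V W f"
    and \<xi>: "\<xi> \<in> smooth_tensor smul V"
  shows "(\<lambda>t. f (\<xi> t)) \<in> smooth_tensor smul W"
proof -
  interpret vector_space smul by (rule vs)
  show ?thesis
    using vs \<xi>
  proof (induction rule: smooth_tensor_induct)
    case zero
    show ?case
      using smooth_tensor_zero linear_on_zero[OF f subspace_0[OF V]] by (simp add: zero_fun_def)
  next
    case (add_pure \<xi> v g)
    have "f ((\<xi> + pure_tensor smul v g) t) = f (\<xi> t) + pure_tensor smul (f v) g t" for t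
      using linear_on_add[OF f smooth_tensor_value[OF V add_pure(1)], of "smul (g t) v"]
        linear_on_scale[OF f add_pure(2)] subspace_scale[OF V add_pure(2)]
      by (simp add: pure_tensor_def)
    then have "(\<lambda>t. f ((\<xi> + pure_tensor smul v g) t)) =
        (\<lambda>t. f (\<xi> t)) + pure_tensor smul (f v) g"
      by (simp add: fun_eq_iff)
    moreover have "f v \<in> W"
      using f add_pure(2) by (simp add: linear_on_def)
    ultimately show ?case
      by (simp add: smooth_tensor_add[OF add_pure(4) smooth_tensor_pure[OF _ add_pure(3)]])
  qed
qed

lemma smooth_tensor_smooth_scale:
  assumes "smooth g" "\<xi> \<in> smooth_tensor smul V"
  shows "(\<lambda>t. smul (g t) (\<xi> t)) \<in> smooth_tensor smul V"
proof -
  interpret vector_space smul by (rule vs)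
  show ?thesis
    using vs assms(2)
  proof (induction rule: smooth_tensor_induct)
    case zero
    show ?case using smooth_tensor_zero by (simp add: zero_fun_def)
  next
    case (add_pure \<xi> v h)
    have "(\<lambda>t. smul (g t) ((\<xi> + pure_tensor smul v h) t)) =
        (\<lambda>t. smul (g t) (\<xi> t)) + pure_tensor smul v (\<lambda>t. g t * h t)"
      by (simp add: fun_eq_iff pure_tensor_def scale_right_distrib)
    also have "\<dots> \<in> smooth_tensor smul V"
      by (rule smooth_tensor_add[OF add_pure(4)
            smooth_tensor_pure[OF add_pure(2) smooth_mult[OF assms(1) add_pure(3)]]])
    finally show ?case .
  qed
qed

text \<open>
  Induction on \<open>\<xi>\<close> alone suffices: for a pure tensor \<open>\<xi>\<close> of \<open>v\<close> and \<open>g\<close> the value is \<open>g\<close> times the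
  image of \<open>\<eta>\<close> under the linear map \<open>f v\<close>.
\<close>

lemma smooth_tensor_bilinear_image:
  assumes V: "module.subspace smul V" and U: "module.subspace smul U"
    and left: "\<And>y. y \<in> U \<Longrightarrow> linear_on smul smul V W (\<lambda>x. f x y)"
    and right: "\<And>x. x \<in> V \<Longrightarrow> linear_on smul smul U W (f x)"
    and \<xi>: "\<xi> \<in> smooth_tensor smul V" and \<eta>: "\<eta> \<in> smooth_tensor smul U"
  shows "(\<lambda>t. f (\<xi> t) (\<eta> t)) \<in> smooth_tensor smul W"
proof -
  interpret vector_space smul by (rule vs)
  note \<eta>_value = smooth_tensor_value[OF U \<eta>]
  show ?thesis
    using vs \<xi>
  proof (induction rule: smooth_tensor_induct)
    case zero
    have "f 0 (\<eta> t) = 0" for t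
      by (rule linear_on_zero[OF left[OF \<eta>_value] subspace_0[OF V]])
    then show ?case using smooth_tensor_zero by (simp add: zero_fun_def)
  next
    case (add_pure \<xi> v g)
    have "f ((\<xi> + pure_tensor smul v g) t) (\<eta> t) = f (\<xi> t) (\<eta> t) + smul (g t) (f v (\<eta> t))" for t
      using linear_on_add[OF left[OF \<eta>_value] smooth_tensor_value[OF V add_pure(1)], of "smul (g t) v"]
        linear_on_scale[OF left[OF \<eta>_value] add_pure(2)] subspace_scale[OF V add_pure(2)]
      by (simp add: pure_tensor_def)
    then have "(\<lambda>t. f ((\<xi> + pure_tensor smul v g) t) (\<eta> t)) =
        (\<lambda>t. f (\<xi> t) (\<eta> t)) + (\<lambda>t. smul (g t) (f v (\<eta> t)))"
      by (simp add: fun_eq_iff)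
    also have "\<dots> \<in> smooth_tensor smul W"
      by (rule smooth_tensor_add[OF add_pure(4) smooth_tensor_smooth_scale[OF add_pure(3)
            smooth_tensor_linear_image[OF U right[OF add_pure(2)] \<eta>]]])
    finally show ?case .
  qed
qed

end

section \<open>The shear between the deformations\<close>

definition shear ::
  "('k::real_normed_field \<Rightarrow> 'v::ab_group_add \<Rightarrow> 'v) \<Rightarrow> (int \<Rightarrow> 'v \<Rightarrow> 'v) \<Rightarrow> real \<Rightarrow> int \<Rightarrow>
    'v path_form \<Rightarrow> 'v path_form" where
  "shear smul \<delta> \<alpha> n =
     (\<lambda>(\<xi>, \<omega>). (\<xi>, \<lambda>t. \<omega> t - smul ((- 1) powi n * of_real \<alpha>) (\<delta> n (\<xi> t))))"

locale dga_with_delta = dga smul F d w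
  for smul :: "'k::real_normed_field \<Rightarrow> 'v::ab_group_add \<Rightarrow> 'v"
    and F :: "int \<Rightarrow> 'v set"
    and d :: "int \<Rightarrow> 'v \<Rightarrow> 'v"
    and w :: "int \<Rightarrow> int \<Rightarrow> 'v \<Rightarrow> 'v \<Rightarrow> 'v" +
  fixes \<delta> :: "int \<Rightarrow> 'v \<Rightarrow> 'v"
  assumes \<delta>_linear: "linear_on smul smul (F n) (F (n - 1)) (\<delta> n)"
begin

lemmas vs = vector_space_axioms

lemma tensor_value: "\<xi> \<in> smooth_tensor smul (F n) \<Longrightarrow> \<xi> t \<in> F n"
  by (rule smooth_tensor_value[OF vs subspace_F])

lemma path_space_zero: "0 \<in> path_space smul F n"
  by (simp add: path_space_def zero_prod_def smooth_tensor_zero[OF vs])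

lemma path_space_add:
  "\<lbrakk>x \<in> path_space smul F n; y \<in> path_space smul F n\<rbrakk> \<Longrightarrow> x + y \<in> path_space smul F n"
  by (auto simp: path_space_def smooth_tensor_add[OF vs])

lemma path_space_scale: "x \<in> path_space smul F n \<Longrightarrow> path_scale smul c x \<in> path_space smul F n"
  by (auto simp: path_space_def path_scale_def smooth_tensor_scale[OF vs])

lemma path_d_undeformed:
  "path_d smul d \<delta> 0 n (\<xi>, \<omega>) =
    ((\<lambda>t. d n (\<xi> t)), fun_scale smul ((- 1) powi n) (time_deriv smul \<xi>) + (\<lambda>t. d (n - 1) (\<omega> t)))"
  by (simp add: path_d_def fun_scale_def fun_eq_iff)

lemma path_wedge_undeformed:
  "path_wedge smul w \<delta> 0 n m (\<xi>, \<omega>) (\<eta>, \<zeta>) =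
    ((\<lambda>t. w n m (\<xi> t) (\<eta> t)),
     fun_scale smul ((- 1) powi m) (\<lambda>t. w (n - 1) m (\<omega> t) (\<eta> t)) + (\<lambda>t. w n (m - 1) (\<xi> t) (\<zeta> t)))"
  by (simp add: path_wedge_def fun_scale_def fun_eq_iff)

lemma path_d_in_path_space:
  assumes "x \<in> path_space smul F n"
  shows "path_d smul d \<delta> 0 n x \<in> path_space smul F (n + 1)"
proof -
  obtain \<xi> \<omega> where x: "x = (\<xi>, \<omega>)" by fastforce
  with assms have *: "\<xi> \<in> smooth_tensor smul (F n)" "\<omega> \<in> smooth_tensor smul (F (n - 1))"
    by (auto simp: path_space_def)
  have "(\<lambda>t. d n (\<xi> t)) \<in> smooth_tensor smul (F (n + 1))"
    by (rule smooth_tensor_linear_image[OF vs subspace_F d_linear *(1)])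
  moreover have "(\<lambda>t. d (n - 1) (\<omega> t)) \<in> smooth_tensor smul (F n)"
    using smooth_tensor_linear_image[OF vs subspace_F d_linear *(2)] by simp
  ultimately show ?thesis
    unfolding x path_d_undeformed path_space_def
    by (intro SigmaI smooth_tensor_add[OF vs] smooth_tensor_scale[OF vs]
        smooth_tensor_time_deriv[OF vs]) (use *(1) in simp_all)
qed

lemma tensor_w:
  assumes "\<xi> \<in> smooth_tensor smul (F n)" "\<eta> \<in> smooth_tensor smul (F m)" "n + m = k"
  shows "(\<lambda>t. w n m (\<xi> t) (\<eta> t)) \<in> smooth_tensor smul (F k)"
  unfolding assms(3)[symmetric]
proof (rule smooth_tensor_bilinear_image[OF vs subspace_F subspace_F _ _ assms(1,2)])
  show "linear_on smul smul (F n) (F (n + m)) (\<lambda>x. w n m x y)" if "y \<in> F m" for y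
    using that by (rule w_linear_left)
  show "linear_on smul smul (F m) (F (n + m)) (w n m x)" if "x \<in> F n" for x
    using that by (rule w_linear_right)
qed

lemma path_wedge_in_path_space:
  assumes "x \<in> path_space smul F n" "y \<in> path_space smul F m"
  shows "path_wedge smul w \<delta> 0 n m x y \<in> path_space smul F (n + m)"
proof -
  obtain \<xi> \<omega> \<eta> \<zeta> where xy: "x = (\<xi>, \<omega>)" "y = (\<eta>, \<zeta>)"
    by (cases x, cases y)
  with assms have *: "\<xi> \<in> smooth_tensor smul (F n)" "\<omega> \<in> smooth_tensor smul (F (n - 1))"
    "\<eta> \<in> smooth_tensor smul (F m)" "\<zeta> \<in> smooth_tensor smul (F (m - 1))"
    by (auto simp: path_space_def)
  have "(\<lambda>t. w n m (\<xi> t) (\<eta> t)) \<in> smooth_tensor smul (F (n + m))"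
    by (rule tensor_w[OF *(1,3)]) simp
  moreover have "(\<lambda>t. w (n - 1) m (\<omega> t) (\<eta> t)) \<in> smooth_tensor smul (F (n + m - 1))"
    by (rule tensor_w[OF *(2,3)]) simp
  moreover have "(\<lambda>t. w n (m - 1) (\<xi> t) (\<zeta> t)) \<in> smooth_tensor smul (F (n + m - 1))"
    by (rule tensor_w[OF *(1,4)]) simp
  ultimately show ?thesis
    unfolding xy path_wedge_undeformed path_space_def
    by (intro SigmaI smooth_tensor_add[OF vs] smooth_tensor_scale[OF vs])
qed

lemma shear_in_path_space:
  assumes "x \<in> path_space smul F n"
  shows "shear smul \<delta> \<alpha> n x \<in> path_space smul F n"
proof -
  obtain \<xi> \<omega> where x: "x = (\<xi>, \<omega>)" by fastforce
  with assms have *: "\<xi> \<in> smooth_tensor smul (F n)" "\<omega> \<in> smooth_tensor smul (F (n - 1))"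
    by (auto simp: path_space_def)
  have "shear smul \<delta> \<alpha> n x =
      (\<xi>, \<omega> + fun_scale smul (- ((- 1) powi n * of_real \<alpha>)) (\<lambda>t. \<delta> n (\<xi> t)))"
    by (simp add: x shear_def fun_scale_def fun_eq_iff)
  moreover have "(\<lambda>t. \<delta> n (\<xi> t)) \<in> smooth_tensor smul (F (n - 1))"
    by (rule smooth_tensor_linear_image[OF vs subspace_F \<delta>_linear *(1)])
  ultimately show ?thesis
    unfolding path_space_def
    using * by (auto intro: smooth_tensor_add[OF vs] smooth_tensor_scale[OF vs])
qed

lemma shear_linear:
  "linear_on (path_scale smul) (path_scale smul) (path_space smul F n) (path_space smul F n)
    (shear smul \<delta> \<alpha> n)"
  unfolding linear_on_def
proof (intro conjI ballI allI)
  fix x y assume "x \<in> path_space smul F n" "y \<in> path_space smul F n"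
  then obtain \<xi> \<omega> \<eta> \<zeta> where xy: "x = (\<xi>, \<omega>)" "y = (\<eta>, \<zeta>)"
    and mem: "\<xi> t \<in> F n" "\<eta> t \<in> F n" for t
    by (auto simp: path_space_def tensor_value)
  show "shear smul \<delta> \<alpha> n (x + y) = shear smul \<delta> \<alpha> n x + shear smul \<delta> \<alpha> n y"
    by (simp add: xy shear_def fun_eq_iff linear_on_add[OF \<delta>_linear mem] scale_right_distrib
        add_diff_add)
next
  fix x c assume "x \<in> path_space smul F n"
  then obtain \<xi> \<omega> where x: "x = (\<xi>, \<omega>)" and mem: "\<xi> t \<in> F n" for t
    by (auto simp: path_space_def tensor_value)
  show "shear smul \<delta> \<alpha> n (path_scale smul c x) = path_scale smul c (shear smul \<delta> \<alpha> n x)"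
    by (simp add: x shear_def path_scale_def fun_scale_def fun_eq_iff
        linear_on_scale[OF \<delta>_linear mem] scale_right_diff_distrib mult.commute)
qed (rule shear_in_path_space)

lemma shear_bij: "bij_betw (shear smul \<delta> \<alpha> n) (path_space smul F n) (path_space smul F n)"
  by (rule bij_betw_byWitness[where f' = "shear smul \<delta> (- \<alpha>) n"])
     (auto simp: shear_in_path_space, auto simp: shear_def)

text \<open>
  Only the coefficient of \<open>dt\<close> needs an argument: there \<open>d\<^sub>\<alpha>\<close> has \<open>(-1)\<^sup>n \<alpha> (\<delta> d + d \<delta>) \<xi>\<close>,
  the shear before it cancels the summand with \<open>d \<delta>\<close>, and the shear after the undeformed
  differential, now in degree \<open>n + 1\<close> and so with the opposite sign, supplies the one with \<open>\<delta> d\<close>.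
\<close>

lemma path_d_shear:
  assumes "x \<in> path_space smul F n"
  shows "shear smul \<delta> \<alpha> (n + 1) (path_d smul d \<delta> 0 n x) = path_d smul d \<delta> \<alpha> n (shear smul \<delta> \<alpha> n x)"
proof -
  obtain \<xi> \<omega> where x: "x = (\<xi>, \<omega>)" by fastforce
  with assms have \<xi>: "\<xi> t \<in> F n" and \<omega>: "\<omega> t \<in> F (n - 1)" for t
    by (auto simp: path_space_def tensor_value)
  define s :: 'k where "s = (- 1) powi n"
  have s: "(- 1) powi (n + 1) = - s"
    by (simp add: s_def power_int_add)
  have \<delta>\<xi>: "\<delta> n (\<xi> t) \<in> F (n - 1)" for t
    using \<delta>_linear \<xi> by (simp add: linear_on_def)
  have "d (n - 1) (\<omega> t - smul c (\<delta> n (\<xi> t))) = d (n - 1) (\<omega> t) - smul c (d (n - 1) (\<delta> n (\<xi> t)))"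
    for c t
    using linear_on_add[OF d_linear \<omega> subspace_scale[OF subspace_F \<delta>\<xi>], of t "- c" t]
      linear_on_scale[OF d_linear \<delta>\<xi>, of "- c" t] by simp
  then show ?thesis
    by (simp add: x shear_def path_d_def laplacian_def fun_eq_iff s s_def[symmetric]
        scale_right_distrib)
qed

text \<open>
  The shears of the two factors contribute multiples of \<open>\<delta> \<xi> \<and> \<eta>\<close> and \<open>\<xi> \<and> \<delta> \<eta>\<close> that cancel
  those terms of the deformed product. What remains of the deformation is the term with
  \<open>\<delta> (\<xi> \<and> \<eta>)\<close>, and that is the contribution of the shear of the undeformed product.
\<close>

lemma path_wedge_shear:
  assumes "x \<in> path_space smul F n" "y \<in> path_space smul F m"
  shows "shear smul \<delta> \<alpha> (n + m) (path_wedge smul w \<delta> 0 n m x y) =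
    path_wedge smul w \<delta> \<alpha> n m (shear smul \<delta> \<alpha> n x) (shear smul \<delta> \<alpha> m y)"
proof -
  obtain \<xi> \<omega> \<eta> \<zeta> where xy: "x = (\<xi>, \<omega>)" "y = (\<eta>, \<zeta>)"
    by (cases x, cases y)
  with assms have \<xi>: "\<xi> t \<in> F n" and \<omega>: "\<omega> t \<in> F (n - 1)"
    and \<eta>: "\<eta> t \<in> F m" and \<zeta>: "\<zeta> t \<in> F (m - 1)" for t
    by (auto simp: path_space_def tensor_value)
  have \<delta>\<xi>: "\<delta> n (\<xi> t) \<in> F (n - 1)" and \<delta>\<eta>: "\<delta> m (\<eta> t) \<in> F (m - 1)" for t
    using \<delta>_linear \<xi> \<eta> by (simp_all add: linear_on_def)
  define s :: 'k where "s = (- 1) powi n"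
  define r :: 'k where "r = (- 1) powi m"
  have sr: "(- 1) powi (n + m) = s * r"
    by (simp add: s_def r_def power_int_add)
  have "s * s = 1"
    by (simp add: s_def flip: power_int_mult_distrib)
  then have ss: "s * r * a * s = r * a" for a
    by (metis mult.assoc mult.commute mult_1)
  have left: "w (n - 1) m (\<omega> t - smul c (\<delta> n (\<xi> t))) (\<eta> t) =
      w (n - 1) m (\<omega> t) (\<eta> t) - smul c (w (n - 1) m (\<delta> n (\<xi> t)) (\<eta> t))" for c t
    using linear_on_add[OF w_linear_left[OF \<eta>] \<omega> subspace_scale[OF subspace_F \<delta>\<xi>],
        of t "- c" t t]
      linear_on_scale[OF w_linear_left[OF \<eta>] \<delta>\<xi>, of "- c" t t] by simp
  have right: "w n (m - 1) (\<xi> t) (\<zeta> t - smul c (\<delta> m (\<eta> t))) =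
      w n (m - 1) (\<xi> t) (\<zeta> t) - smul c (w n (m - 1) (\<xi> t) (\<delta> m (\<eta> t)))" for c t
    using linear_on_add[OF w_linear_right[OF \<xi>] \<zeta> subspace_scale[OF subspace_F \<delta>\<eta>],
        of t t "- c" t]
      linear_on_scale[OF w_linear_right[OF \<xi>] \<delta>\<eta>, of t "- c" t] by simp
  have r_s: "r * (s * a) = s * r * a" for a
    by (simp add: mult_ac)
  show ?thesis
    by (simp add: xy shear_def path_wedge_def fun_eq_iff left right sr ss r_s s_def[symmetric]
        r_def[symmetric] scale_right_diff_distrib)
qed

end

theorem corollary4p1:
  fixes smul :: "'k::real_normed_field \<Rightarrow> 'v::ab_group_add \<Rightarrow> 'v"
    and F :: "int \<Rightarrow> 'v set"
    and d \<delta> :: "int \<Rightarrow> 'v \<Rightarrow> 'v"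
    and w :: "int \<Rightarrow> int \<Rightarrow> 'v \<Rightarrow> 'v \<Rightarrow> 'v"
    and \<alpha> :: real
  assumes "dga smul F d w"
    and "\<And>n. linear_on smul smul (F n) (F (n - 1)) (\<delta> n)"
  shows "cohomology_isomorphic
      (path_scale smul) (path_space smul F) (path_d smul d \<delta> 0) (path_wedge smul w \<delta> 0)
      (path_scale smul) (path_space smul F) (path_d smul d \<delta> \<alpha>) (path_wedge smul w \<delta> \<alpha>)"
proof -
  interpret dga_with_delta smul F d w \<delta>
    using assms by (intro dga_with_delta.intro dga_with_delta_axioms.intro)
  show ?thesis
    by (rule cohomology_isomorphic_if_dga_isomorphic[where T = "shear smul \<delta> \<alpha>"])
       (rule path_space_zero path_space_add path_space_scale path_d_in_path_space
         path_wedge_in_path_space shear_linear shear_bij path_d_shear path_wedge_shear; assumption)+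
qed

end
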